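(* Let $Z$ be an $n$-dimensional fake weighted projective space, and fix an isomorphism $\mathrm{Cl}(Z)\cong\mathbb{Z}\oplus\mathbb{Z}/\mu_1\mathbb{Z}\oplus\dots\oplus\mathbb{Z}/\mu_r\mathbb{Z}$ (with $\mu_r\mid\dots\mid\mu_1$) under which the classes of the torus-invariant prime divisors $D_0,\dots,D_n$ correspond to $\omega_i=(w_i,\eta_i)$ with $w_i\in\mathbb{Z}_{\ge1}$ and $\eta_i=(\eta_{i1},\dots,\eta_{ir})$, $\eta_{ij}\in\mathbb{Z}/\mu_j\mathbb{Z}$. Let $\eta'_{ij}\in\{0,\dots,\mu_j-1\}$ be the representative of $\eta_{ij}$, and set $L=\mathrm{lcm}(w_0,\dots,w_n)$, $L_{ij}=\frac{L}{w_i}\eta'_{ij}$, $M_j=\frac{\mu_j}{\gcd(\mu_j,L_{0j},\dots,L_{nj})}$ for $j=1,\dots,r$, and $M=\mathrm{lcm}(M_1,\dots,M_r)$. Then, under this identification, $\mathrm{Pic}(Z)$ is the subgroup generated by $(LM,0)$, and the Gorenstein index of $Z$ is $$\iota(Z)=\mathrm{lcm}\left(\frac{LM}{\gcd\left(LM,\sum_i w_i\right)},\ \frac{\mu_j}{\gcd\left(\mu_j,\sum_i\eta'_{ij}\right)};\ j=1,\dots,r\right).$$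
   Context: A fake weighted projective space (fwps) of dimension $n$ is the toric variety $Z=Z(P)$ whose fan has as maximal cones the cones over the facets of $\mathrm{conv}(v_0,\dots,v_n)$, where $P=[v_0,\dots,v_n]$ is an integer $n\times(n+1)$ matrix whose columns are pairwise distinct primitive vectors generating $\mathbb{R}^n$ as a convex cone; equivalently a $\mathbb{Q}$-factorial toric Fano variety of Picard number one. Its divisor class group is $\mathrm{Cl}(Z)\cong\mathbb{Z}^{n+1}/\mathrm{im}(P^{T})$, where $e_i$ maps to the class of the torus-invariant prime divisor $D_i$ corresponding to $v_i$. $\mathrm{Pic}(Z)\subseteq\mathrm{Cl}(Z)$ is the subgroup of classes of Cartier divisors. The anticanonical class is $\sum_i[D_i]$, and the Gorenstein index $\iota(Z)$ is the smallest positive integer $k$ such that $k$ times the anticanonical divisor is Cartier. *)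

theory Defs
  imports
    "HOL-Analysis.Analysis"
    "HOL-Algebra.Product_Groups"
    "HOL-Library.Poly_Mapping"
begin

section \<open>Fake weighted projective spaces\<close>

(* The columns of P, a matrix with CARD('n) rows, are the vectors v_0, ..., v_n; they are indexed
   by a finite type 'm with CARD('m) = CARD('n) + 1 and live in the lattice N = Z^n = int ^ 'n.
   The dual lattice M is identified with int ^ 'n via the standard pairing. *)

definition real_vec :: "int ^ 'n \<Rightarrow> real ^ 'n" where
  "real_vec v = (\<chi> k. of_int (v $ k))"

definition pairing :: "int ^ 'n \<Rightarrow> int ^ 'n \<Rightarrow> int" where
  "pairing m v = (\<Sum>k\<in>UNIV. m $ k * v $ k)"

definition primitive :: "int ^ 'n \<Rightarrow> bool" where
  "primitive v \<longleftrightarrow> Gcd (range (\<lambda>k. v $ k)) = 1"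

definition ray :: "int ^ 'm ^ 'n \<Rightarrow> 'm \<Rightarrow> real ^ 'n" where
  "ray P i = real_vec (column i P)"

definition fwps_matrix :: "int ^ 'm ^ 'n \<Rightarrow> bool" where
  "fwps_matrix P \<longleftrightarrow>
     CARD('m) = CARD('n) + 1 \<and>
     inj (\<lambda>i. column i P) \<and>
     (\<forall>i. primitive (column i P)) \<and>
     convex_cone hull (range (ray P)) = UNIV"

(* The fan of Z(P) is given by its maximal cones. *)
definition maximal_cones :: "int ^ 'm ^ 'n \<Rightarrow> (real ^ 'n) set set" where
  "maximal_cones P = {conic hull F | F. F facet_of (convex hull (range (ray P)))}"


section \<open>The affine charts\<close>

(* Laurent polynomials, i.e. regular functions on the torus Spec C[M]; the coefficient of the
   character chi^m is the value at m, and multiplication is convolution. *)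
type_synonym 'n laurent = "(int ^ 'n) \<Rightarrow>\<^sub>0 complex"

definition dual_monoid :: "(real ^ 'n) set \<Rightarrow> (int ^ 'n) set" where
  "dual_monoid \<sigma> = {m. \<forall>y\<in>\<sigma>. 0 \<le> real_vec m \<bullet> y}"

(* The affine chart U_sigma of Z(P) is Spec C[S] with S = dual_monoid sigma. *)
definition chart_ring :: "(real ^ 'n) set \<Rightarrow> 'n laurent set" where
  "chart_ring \<sigma> = {f. Poly_Mapping.keys f \<subseteq> dual_monoid \<sigma>}"

(* Closed points of U_sigma, i.e. C-algebra homomorphisms C[S] -> C, encoded as monoid
   homomorphisms from S to the multiplicative monoid C; their behaviour outside S is
   irrelevant. *)
definition chart_points :: "(real ^ 'n) set \<Rightarrow> ((int ^ 'n) \<Rightarrow> complex) set" where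
  "chart_points \<sigma> =
     {x. x 0 = 1 \<and> (\<forall>m\<in>dual_monoid \<sigma>. \<forall>m'\<in>dual_monoid \<sigma>. x (m + m') = x m * x m')}"

definition eval_at :: "((int ^ 'n) \<Rightarrow> complex) \<Rightarrow> 'n laurent \<Rightarrow> complex" where
  "eval_at x f = (\<Sum>m\<in>Poly_Mapping.keys f. Poly_Mapping.lookup f m * x m)"


section \<open>Divisors\<close>

(* A torus-invariant Weil divisor sum_i a_i D_i is the integer vector a :: int ^ 'm. *)

(* Order of vanishing of a nonzero Laurent polynomial along D_i: the monomial valuation with
   chi^m |-> <m, v_i>. *)
definition ord_along :: "int ^ 'm ^ 'n \<Rightarrow> 'm \<Rightarrow> 'n laurent \<Rightarrow> int" where
  "ord_along P i f = Min ((\<lambda>m. pairing m (column i P)) ` Poly_Mapping.keys f)"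

(* Sections of O(D) over U_sigma: rational functions f with f = 0 or div f + D effective on
   U_sigma. Effectivity on the torus means that f is a Laurent polynomial, and the complement of
   the torus in U_sigma consists of the D_i with v_i in sigma. *)
definition divisor_sections ::
    "int ^ 'm ^ 'n \<Rightarrow> (real ^ 'n) set \<Rightarrow> int ^ 'm \<Rightarrow> 'n laurent set" where
  "divisor_sections P \<sigma> a =
     {f. f \<noteq> 0 \<longrightarrow> (\<forall>i. ray P i \<in> \<sigma> \<longrightarrow> 0 \<le> ord_along P i f + a $ i)}"

(* D is Cartier iff it is locally principal: every point x has a neighbourhood on which the
   (fractional ideal) sheaf O(-D) is generated by a single rational function f, the local
   equation of D. The neighbourhood is the principal open set {s \<noteq> 0} of a chart, whose
   coordinate ring and sections of O(-D) are the localizations at s; the last line says that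
   every section of O(-D) over U_sigma lies in f times this localized ring. *)
definition cartier :: "int ^ 'm ^ 'n \<Rightarrow> int ^ 'm \<Rightarrow> bool" where
  "cartier P a \<longleftrightarrow>
     (\<forall>\<sigma>\<in>maximal_cones P. \<forall>x\<in>chart_points \<sigma>.
        \<exists>s\<in>chart_ring \<sigma>. eval_at x s \<noteq> 0 \<and>
          (\<exists>f\<in>divisor_sections P \<sigma> (- a). f \<noteq> 0 \<and>
             (\<forall>g\<in>divisor_sections P \<sigma> (- a). \<exists>k. \<exists>h\<in>chart_ring \<sigma>. s ^ k * g = h * f)))"

definition divisor_group :: "(int ^ 'm) monoid" where
  "divisor_group = \<lparr>carrier = UNIV, monoid.mult = (+), one = 0\<rparr>"

(* im(P^T): the divisors of the characters of the torus. *)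
definition principal_divisors :: "int ^ 'm ^ 'n \<Rightarrow> (int ^ 'm) set" where
  "principal_divisors P = range (\<lambda>u. transpose P *v u)"

definition class_group :: "int ^ 'm ^ 'n \<Rightarrow> (int ^ 'm) set monoid" where
  "class_group P = divisor_group Mod principal_divisors P"

definition divisor_class :: "int ^ 'm ^ 'n \<Rightarrow> int ^ 'm \<Rightarrow> (int ^ 'm) set" where
  "divisor_class P a = principal_divisors P #>\<^bsub>divisor_group\<^esub> a"

definition prime_divisor :: "'m \<Rightarrow> int ^ 'm" where
  "prime_divisor i = axis i 1"

(* Every class contains torus-invariant divisors, and being Cartier depends only on the class. *)
definition picard_group :: "int ^ 'm ^ 'n \<Rightarrow> (int ^ 'm) set set" where
  "picard_group P = divisor_class P ` {a. cartier P a}"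

definition anticanonical_divisor :: "int ^ 'm" where
  "anticanonical_divisor = (\<Sum>i\<in>UNIV. prime_divisor i)"

definition gorenstein_index :: "int ^ 'm ^ 'n \<Rightarrow> nat" where
  "gorenstein_index P = (LEAST k. 0 < k \<and> cartier P (int k *s anticanonical_divisor))"


section \<open>The grading group\<close>

(* Z + Z/mu_1 + ... + Z/mu_r; elements of Z/mu_j are represented by integers in {0..<mu_j}. *)
definition grading_group :: "nat \<Rightarrow> (nat \<Rightarrow> nat) \<Rightarrow> (int \<times> (nat \<Rightarrow> int)) monoid" where
  "grading_group r \<mu> =
     integer_group \<times>\<times> product_group {1..r} (\<lambda>j. integer_mod_group (\<mu> j))"

end

theory Submission
  imports Defs "HOL-Number_Theory.Cong"
begin

text \<open>
  On the chart missing \<open>D\<^sub>i\<close>, comparing the sections of \<open>\<O>(-D)\<close> at the torus-fixed point shows that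
  \<open>D\<close> is Cartier iff it agrees there with the divisor of a character, that is, iff its class is a
  multiple of \<open>\<omega>\<^sub>i\<close>. Hence \<open>Pic(Z)\<close> is the intersection of the groups generated by the \<open>\<omega>\<^sub>i\<close>. It has no
  torsion component in any splitting: if \<open>x = (l, \<tau>) = c\<^sub>i \<omega>\<^sub>i\<close> for all \<open>i\<close>, then \<open>w\<^sub>i x = l \<omega>\<^sub>i\<close>, and
  choosing \<open>b\<close> with \<open>\<Sum> b\<^sub>i \<omega>\<^sub>i = (1, 0)\<close> gives \<open>x = \<Sum> b\<^sub>i w\<^sub>i x = (l, 0)\<close>. It remains to solve
  \<open>l = c\<^sub>i w\<^sub>i\<close>, \<open>c\<^sub>i \<eta>\<^sub>i = 0\<close> for all \<open>i\<close>, which means \<open>L M dvd l\<close>.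
\<close>

section \<open>Laurent polynomials and additive functions\<close>

text \<open>If \<open>a + b\<close> decomposes in only one way into exponents of the factors, the
  convolution sum has a single term and nothing can cancel. This does the work of a leading-term
  argument without ordering the exponents.\<close>

lemma lookup_mult_unique:
  fixes f g :: "'a::comm_monoid_add \<Rightarrow>\<^sub>0 'b::comm_semiring_0"
  assumes "\<And>p q. p \<in> Poly_Mapping.keys f \<Longrightarrow> q \<in> Poly_Mapping.keys g \<Longrightarrow> p + q = a + b
             \<Longrightarrow> p = a \<and> q = b"
  shows "Poly_Mapping.lookup (f * g) (a + b) = Poly_Mapping.lookup f a * Poly_Mapping.lookup g b"
proof -
  let ?h = "\<lambda>(p, q). Poly_Mapping.lookup f p * Poly_Mapping.lookup g q when a + b = p + q"
  have "Poly_Mapping.lookup (f * g) (a + b) = Sum_any ?h"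
    by (simp add: times_poly_mapping.rep_eq prod_fun_unfold_prod)
  also have "\<dots> = sum ?h {(a, b)}"
  proof (rule Sum_any.expand_superset)
    show "{x. ?h x \<noteq> 0} \<subseteq> {(a, b)}"
      using assms by (auto simp: in_keys_iff when_def split: if_splits) (metis mult_zero_left mult_zero_right)+
  qed auto
  finally show ?thesis by simp
qed

text \<open>Zero is the only invertible element. For the exponents of a chart ring, this makes
  taking the constant term multiplicative, which is evaluation at the torus-fixed point.\<close>

definition pointed_monoid :: "'a::comm_monoid_add set \<Rightarrow> bool" where
  "pointed_monoid S \<longleftrightarrow> 0 \<in> S \<and> (\<forall>p\<in>S. \<forall>q\<in>S. p + q \<in> S \<and> (p + q = 0 \<longrightarrow> p = 0))"

lemma pointed_monoidD:
  assumes "pointed_monoid S"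
  shows "0 \<in> S" "p \<in> S \<Longrightarrow> q \<in> S \<Longrightarrow> p + q \<in> S"
    "p \<in> S \<Longrightarrow> q \<in> S \<Longrightarrow> p + q = 0 \<Longrightarrow> p = 0 \<and> q = 0"
  using assms unfolding pointed_monoid_def by (blast, blast, metis add.commute)

text \<open>In a pointed monoid \<open>0\<close> has only the decomposition \<open>0 + 0\<close>.
  Hence powers of a function that does not vanish at the fixed point do not vanish there
  either.\<close>

lemma power_constant_term:
  fixes s :: "'a::comm_monoid_add \<Rightarrow>\<^sub>0 'b::comm_semiring_1"
  assumes "pointed_monoid S" "Poly_Mapping.keys s \<subseteq> S"
  shows "Poly_Mapping.keys (s ^ k) \<subseteq> S \<and>
    Poly_Mapping.lookup (s ^ k) 0 = Poly_Mapping.lookup s 0 ^ k"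
proof (induction k)
  case 0
  then show ?case using pointed_monoidD(1)[OF assms(1)]
    by (auto simp: lookup_one keys_def when_def split: if_splits)
next
  case (Suc k)
  have "Poly_Mapping.lookup (s * s ^ k) (0 + 0) = Poly_Mapping.lookup s 0 * Poly_Mapping.lookup (s ^ k) 0"
    using assms Suc pointed_monoidD(3)[OF assms(1)] by (intro lookup_mult_unique) auto
  moreover have "Poly_Mapping.keys (s * s ^ k) \<subseteq> S"
    using keys_mult[of s "s ^ k"] assms Suc pointed_monoidD(2)[OF assms(1)] by blast
  ultimately show ?case using Suc by simp
qed

text \<open>If \<open>f\<close> generates after inverting \<open>s\<close>, then minimality of an
  exponent \<open>u\<close> leaves only one term for the coefficient of \<open>h * f\<close> at
  \<open>u\<close>, so the cofactor \<open>h\<close> has nonzero constant term and is a unit at the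
  fixed point. Two minimal monomials thus differ by such units, and this forces equal
  exponents.\<close>

lemma minimal_exponent_unique:
  fixes f :: "'a::ab_group_add \<Rightarrow>\<^sub>0 'b::idom"
  assumes S: "pointed_monoid S"
    and f: "Poly_Mapping.keys f \<subseteq> A"
    and s: "Poly_Mapping.keys s \<subseteq> S" "Poly_Mapping.lookup s 0 \<noteq> 0"
    and h: "Poly_Mapping.keys h\<^sub>1 \<subseteq> S" "Poly_Mapping.keys h\<^sub>2 \<subseteq> S"
    and eq: "s ^ k\<^sub>1 * Poly_Mapping.single u\<^sub>1 1 = h\<^sub>1 * f"
      "s ^ k\<^sub>2 * Poly_Mapping.single u\<^sub>2 1 = h\<^sub>2 * f"
    and u: "u\<^sub>2 \<in> A"
    and minimal: "\<And>q. q \<in> A \<Longrightarrow> u\<^sub>1 - q \<in> S \<Longrightarrow> q = u\<^sub>1"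
      "\<And>q. q \<in> A \<Longrightarrow> u\<^sub>2 - q \<in> S \<Longrightarrow> q = u\<^sub>2"
  shows "u\<^sub>1 = u\<^sub>2"
proof -
  note SD = pointed_monoidD[OF S]
  let ?g = "\<lambda>k u. s ^ k * Poly_Mapping.single u 1"
  have keys_g: "Poly_Mapping.keys (?g k u) \<subseteq> (\<lambda>p. p + u) ` S" for k u
    using keys_mult[of "s ^ k" "Poly_Mapping.single u 1"] power_constant_term[OF S s(1), of k] by auto
  have lookup_g: "Poly_Mapping.lookup (?g k u) u \<noteq> 0" for k u
    using lookup_mult_unique[of "s ^ k" "Poly_Mapping.single u 1" 0 u] power_constant_term[OF S s(1), of k] s(2)
    by simp
  have h0: "Poly_Mapping.lookup h 0 \<noteq> 0"
    if "?g k u = h * f" "Poly_Mapping.keys h \<subseteq> S" "\<And>q. q \<in> A \<Longrightarrow> u - q \<in> S \<Longrightarrow> q = u" for k u h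
  proof -
    have "Poly_Mapping.lookup (h * f) (0 + u) = Poly_Mapping.lookup h 0 * Poly_Mapping.lookup f u"
    proof (rule lookup_mult_unique)
      fix p q assume "p \<in> Poly_Mapping.keys h" "q \<in> Poly_Mapping.keys f" "p + q = 0 + u"
      moreover from this have "u - q = p" by (simp add: algebra_simps)
      ultimately have "q = u" using that(2) f by (intro that(3)) auto
      then show "p = 0 \<and> q = u" using \<open>p + q = 0 + u\<close> by simp
    qed
    then show ?thesis using lookup_g[of k u] that(1) by auto
  qed
  \<comment> \<open>Both products equal \<open>h\<^sub>1 * h\<^sub>2 * f\<close>; the coefficient at \<open>u\<^sub>1\<close> on the left is nonzero, and
    the exponents on the right lie in \<open>u\<^sub>2 + S\<close>.\<close>
  have cross: "?g k\<^sub>1 u\<^sub>1 * h\<^sub>2 = ?g k\<^sub>2 u\<^sub>2 * h\<^sub>1"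
    unfolding eq by (simp add: ac_simps)
  have "Poly_Mapping.lookup (?g k\<^sub>1 u\<^sub>1 * h\<^sub>2) (u\<^sub>1 + 0) = Poly_Mapping.lookup (?g k\<^sub>1 u\<^sub>1) u\<^sub>1 * Poly_Mapping.lookup h\<^sub>2 0"
  proof (rule lookup_mult_unique)
    fix p q assume p: "p \<in> Poly_Mapping.keys (?g k\<^sub>1 u\<^sub>1)" and q: "q \<in> Poly_Mapping.keys h\<^sub>2" "p + q = u\<^sub>1 + 0"
    obtain p' where p': "p' \<in> S" "p = p' + u\<^sub>1" using p keys_g by blast
    then have "p' + q = 0" using q(2) by (simp add: algebra_simps)
    then show "p = u\<^sub>1 \<and> q = 0" using SD(3) p' q(1) h(2) by auto
  qed
  then have "u\<^sub>1 \<in> Poly_Mapping.keys (?g k\<^sub>1 u\<^sub>1 * h\<^sub>2)"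
    using lookup_g h0[OF eq(2) h(2) minimal(2)] by (simp add: in_keys_iff)
  then obtain p q where "p \<in> Poly_Mapping.keys (?g k\<^sub>2 u\<^sub>2)" "q \<in> Poly_Mapping.keys h\<^sub>1" "u\<^sub>1 = p + q"
    unfolding cross using keys_mult by blast
  moreover from this obtain p' where "p' \<in> S" "p = p' + u\<^sub>2" using keys_g by blast
  ultimately have "u\<^sub>1 - u\<^sub>2 = p' + q" "p' + q \<in> S" using SD(2) h(1) by (auto simp: algebra_simps)
  then show ?thesis using minimal(1)[OF u] by simp
qed

section \<open>Integer combinations and additive functions on the lattice\<close>

lemma bezout_Gcd_int:
  fixes f :: "'a \<Rightarrow> int"
  assumes "finite I"
  shows "\<exists>c. (\<Sum>i\<in>I. c i * f i) = (GCD i\<in>I. f i)"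
  using assms
proof (induction I)
  case (insert x I)
  then obtain c where c: "(\<Sum>i\<in>I. c i * f i) = (GCD i\<in>I. f i)" by blast
  obtain a b where ab: "a * f x + b * (GCD i\<in>I. f i) = gcd (f x) (GCD i\<in>I. f i)"
    using bezout_int by blast
  have "(\<Sum>i\<in>I. (if i = x then a else b * c i) * f i) = (\<Sum>i\<in>I. b * (c i * f i))"
    using insert.hyps by (intro sum.cong) (auto simp: mult.assoc)
  also have "\<dots> = b * (GCD i\<in>I. f i)" by (simp add: c flip: sum_distrib_left)
  finally show ?case
    using insert.hyps ab by (intro exI[of _ "\<lambda>i. if i = x then a else b * c i"]) simp
qed simp

text \<open>Working modulo \<open>d\<close> covers both kinds of coordinates of the grading group:
  \<open>d = 0\<close> gives equality for the free part, while reduced residues are additive only up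
  to congruence.\<close>

lemma additive_int_vec_cong:
  fixes f :: "int ^ 'm \<Rightarrow> int"
  assumes add: "\<And>a b. [f (a + b) = f a + f b] (mod d)"
  shows "[f a = (\<Sum>i\<in>UNIV. a $ i * f (axis i 1))] (mod d)"
proof -

  have zero: "[f 0 = 0] (mod d)"
    using add[of 0 0] by (simp add: cong_iff_dvd_diff)
  have "[f (axis i (int n)) = int n * f (axis i 1)] (mod d)" for i n
  proof (induction n)
    case (Suc n)
    have "axis i (int (Suc n)) = (axis i (int n) + axis i 1 :: int ^ 'm)"
      by (simp add: axis_def vec_eq_iff)
    then have "[f (axis i (int (Suc n))) = f (axis i (int n)) + f (axis i 1)] (mod d)"
      using add by metis
    also have "[f (axis i (int n)) + f (axis i 1) = int n * f (axis i 1) + f (axis i 1)] (mod d)"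
      by (intro cong_add Suc cong_refl)
    finally show ?case by (simp add: algebra_simps)
  qed (use zero in \<open>simp add: axis_def vec_eq_iff zero_vec_def\<close>)
  note nat_multiple = this
  have axis_multiple: "[f (axis i c) = c * f (axis i 1)] (mod d)" for i c
  proof (cases "0 \<le> c")
    case True
    then show ?thesis using nat_multiple[of i "nat c"] by simp
  next
    case False
    then have "[f (axis i (-c)) = (-c) * f (axis i 1)] (mod d)" using nat_multiple[of i "nat (-c)"] by simp
    moreover have "(axis i c + axis i (-c) :: int ^ 'm) = 0" by (simp add: axis_def vec_eq_iff)
    then have "[0 = f (axis i c) + f (axis i (-c))] (mod d)"
      using add[of "axis i c" "axis i (-c)"] zero cong_sym cong_trans by metis
    ultimately have "[f (axis i c) + f (axis i (-c)) + (-c) * f (axis i 1) = 0 + f (axis i (-c))] (mod d)"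
      by (intro cong_add) (auto intro: cong_sym)
    then show ?thesis by (simp add: cong_iff_dvd_diff algebra_simps)
  qed
  have "[f (\<Sum>i\<in>I. axis i (a $ i)) = (\<Sum>i\<in>I. a $ i * f (axis i 1))] (mod d)" if "finite I" for I
    using that
  proof (induction I)
    case (insert x I)
    have "[f (axis x (a $ x) + (\<Sum>i\<in>I. axis i (a $ i))) = f (axis x (a $ x)) + f (\<Sum>i\<in>I. axis i (a $ i))] (mod d)"
      by (rule add)
    also have "[f (axis x (a $ x)) + f (\<Sum>i\<in>I. axis i (a $ i)) =
        a $ x * f (axis x 1) + (\<Sum>i\<in>I. a $ i * f (axis i 1))] (mod d)"
      using insert by (intro cong_add axis_multiple)
    finally show ?case using insert.hyps by simp
  qed (simp add: zero)
  from this[of UNIV] have "[f (\<Sum>i\<in>UNIV. axis i (a $ i)) = (\<Sum>i\<in>UNIV. a $ i * f (axis i 1))] (mod d)"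
    by simp
  moreover have "(\<Sum>i\<in>UNIV. axis i (a $ i)) = a"
    by (simp add: vec_eq_iff axis_def if_distrib cong: if_cong)
  ultimately show ?thesis by simp
qed

section \<open>Cartier divisors and local equations\<close>

lemma pairing_add_left: "pairing (u + u') v = pairing u v + pairing u' v"
  by (simp add: pairing_def algebra_simps sum.distrib)

lemma pairing_diff_left: "pairing (u - u') v = pairing u v - pairing u' v"
  by (simp add: pairing_def algebra_simps sum_subtractf)

lemma pairing_scale_left: "pairing (c *s u) v = c * pairing u v"
  by (simp add: pairing_def algebra_simps sum_distrib_left)

lemma pairing_zero_left [simp]: "pairing 0 v = 0"
  by (simp add: pairing_def)

lemma pairing_sum_left: "finite I \<Longrightarrow> pairing (\<Sum>k\<in>I. u k) v = (\<Sum>k\<in>I. pairing (u k) v)"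
  by (induction I rule: finite_induct) (simp_all add: pairing_add_left)

lemma inner_real_vec: "real_vec u \<bullet> real_vec v = of_int (pairing u v)"
  by (simp add: real_vec_def pairing_def inner_vec_def)

lemma inner_ray: "real_vec u \<bullet> ray P i = of_int (pairing u (column i P))"
  by (simp add: ray_def inner_real_vec)

lemma real_vec_eq_0_iff: "real_vec u = 0 \<longleftrightarrow> u = 0"
  by (simp add: real_vec_def vec_eq_iff)

lemma vector_matrix_mult_nth: "(u v* P) $ j = pairing u (column j P)"
  by (simp add: vector_matrix_mult_def column_def pairing_def mult.commute)

text \<open>The vectors in \<open>dual\<close> are, up to scaling, the inner normals of the walls of the fan; together
  with the relation among the columns they carry all the information on the fan that is needed.\<close>

locale weighted_fan =
  fixes P :: "int ^ 'm ^ 'n" and w :: "'m \<Rightarrow> nat"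
  assumes fwps: "fwps_matrix P"
    and w_pos: "1 \<le> w i"
    and relation: "(\<Sum>k\<in>UNIV. int (w k) * pairing u (column k P)) = 0"
    and dual: "i \<noteq> k \<Longrightarrow> \<exists>u. 0 < pairing u (column k P) \<and> pairing u (column i P) < 0 \<and>
        (\<forall>l. l \<noteq> i \<longrightarrow> l \<noteq> k \<longrightarrow> pairing u (column l P) = 0)"
begin

section \<open>Rays and maximal cones of the simplicial fan\<close>

lemma inj_ray: "inj (ray P)"
proof (rule injI, rule ccontr)
  fix i k assume eq: "ray P i = ray P k" and "i \<noteq> k"
  then obtain u where "0 < pairing u (column k P)" "pairing u (column i P) < 0" using dual by blast
  then show False using arg_cong[OF eq, of "\<lambda>y. real_vec u \<bullet> y"] by (simp add: inner_ray)
qed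

lemma ex_other_index: "\<exists>j. j \<noteq> (i::'m)"
proof -
  have "card (UNIV - {i}) \<noteq> 0" using fwps by (simp add: fwps_matrix_def card_Diff_singleton)
  then have "UNIV - {i} \<noteq> {}" by (metis card.empty)
  then show ?thesis by blast
qed

text \<open>The weight relation, with its positive coefficients, forces the pairing with column
  \<open>i\<close> to vanish too. As the rays generate the whole space as a cone, \<open>m\<close>
  is then orthogonal to everything, in particular to itself.\<close>

lemma eq_0_if_pairing_eq_0:
  assumes "\<And>j. j \<noteq> i \<Longrightarrow> pairing m (column j P) = 0"
  shows "m = 0"
proof -
  have "(\<Sum>k\<in>UNIV. int (w k) * pairing m (column k P)) = int (w i) * pairing m (column i P)"
    using assms by (subst sum.remove[of _ i]) auto
  then have "pairing m (column i P) = 0" using relation[of m] w_pos[of i] by simp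
  then have zero: "pairing m (column j P) = 0" for j using assms by (cases "j = i") auto
  have "convex_cone hull (range (ray P)) \<subseteq> {y. real_vec m \<bullet> y = 0}"
    by (rule hull_minimal)
      (auto simp: inner_ray zero convex_cone_def conic_def convex_def inner_add_right intro!: exI[of _ 0])
  then have "real_vec m \<bullet> real_vec m = 0" using fwps unfolding fwps_matrix_def by blast
  then show ?thesis by (simp add: real_vec_eq_0_iff)
qed

text \<open>In a nontrivial linear relation among the rays all coefficients have the same strict
  sign, so they cannot sum to zero. Hence the convex hull of the rays is a simplex.\<close>

lemma affine_independent_rays: "\<not> affine_dependent (range (ray P))"
proof
  assume "affine_dependent (range (ray P))"
  then obtain U i where U: "sum U (range (ray P)) = 0" "U (ray P i) \<noteq> 0"
      "(\<Sum>v\<in>range (ray P). U v *\<^sub>R v) = 0"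
    by (auto simp: affine_dependent_explicit_finite)
  define c where "c k = U (ray P k)" for k
  have c: "(\<Sum>k\<in>UNIV. c k) = 0" "(\<Sum>k\<in>UNIV. c k *\<^sub>R ray P k) = 0"
    using U(1,3) by (simp_all add: sum.reindex[OF inj_ray] c_def)
  \<comment> \<open>Pairing with a wall normal compares the signs of two coefficients.\<close>
  have same_sign: "0 < c k * c i" for k
  proof (cases "k = i")
    case True
    then show ?thesis using U(2) by (simp add: c_def flip: power2_eq_square)
  next
    case False
    then obtain u where u: "0 < pairing u (column k P)" "pairing u (column i P) < 0"
        "\<forall>l. l \<noteq> i \<longrightarrow> l \<noteq> k \<longrightarrow> pairing u (column l P) = 0"
      using dual[OF not_sym[OF False]] by blast
    have "0 = real_vec u \<bullet> (\<Sum>k\<in>UNIV. c k *\<^sub>R ray P k)" using c by simp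
    also have "\<dots> = (\<Sum>l\<in>UNIV. c l * pairing u (column l P))"
      by (simp add: inner_sum_right inner_ray)
    also have "\<dots> = (\<Sum>l\<in>{i, k}. c l * pairing u (column l P))"
      using u(3) by (intro sum.mono_neutral_right) auto
    finally have "c k * pairing u (column k P) = c i * - pairing u (column i P)"
      using False by simp
    then have "c i * (c k * pairing u (column k P)) = c i * (c i * - pairing u (column i P))"
      by simp
    then have "(c k * c i) * pairing u (column k P) = c i ^ 2 * - pairing u (column i P)"
      by (simp add: power2_eq_square algebra_simps)
    moreover have "0 < c i ^ 2 * - pairing u (column i P)" using u(2) U(2) by (simp add: c_def mult_less_0_iff)
    ultimately show ?thesis using u(1) by (metis of_int_0_less_iff zero_less_mult_pos2)
  qed
  have "0 < (\<Sum>k\<in>UNIV. c k * c i)" by (intro sum_pos same_sign) auto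
  then show False using c(1) by (simp flip: sum_distrib_right)
qed

definition chart_cone :: "'m \<Rightarrow> (real ^ 'n) set" where
  "chart_cone i = conic hull (convex hull (ray P ` (- {i})))"

lemma maximal_cones_eq: "maximal_cones P = range chart_cone"
proof -
  have "F facet_of (convex hull (range (ray P))) \<longleftrightarrow> (\<exists>i. F = convex hull (ray P ` (- {i})))" for F
  proof -
    have "range (ray P) - {ray P i} = ray P ` (- {i})" for i
      using inj_ray by (auto dest: injD)
    \<comment> \<open>A facet is nonempty by definition, so each vertex set with one vertex removed
      must still contain something.\<close>
    moreover have "ray P ` (- {i}) \<noteq> {}" for i using ex_other_index[of i] by blast
    ultimately show ?thesis
      by (auto simp: facet_of_convex_hull_affine_independent[OF affine_independent_rays])
  qed
  then show ?thesis by (auto simp: maximal_cones_def chart_cone_def)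
qed

lemma ray_in_cone: "j \<noteq> i \<Longrightarrow> ray P j \<in> chart_cone i"
  unfolding chart_cone_def by (intro hull_inc) auto

lemma cone_subset_halfspace:
  assumes "\<And>j. j \<noteq> i \<Longrightarrow> 0 \<le> pairing m (column j P)"
  shows "chart_cone i \<subseteq> {y. 0 \<le> real_vec m \<bullet> y}"
  unfolding chart_cone_def
proof (intro hull_minimal)
  show "ray P ` (- {i}) \<subseteq> {y. 0 \<le> real_vec m \<bullet> y}" using assms by (auto simp: inner_ray)
  show "convex {y. 0 \<le> real_vec m \<bullet> y}" by (auto simp: convex_def inner_add_right)
  show "conic {y. 0 \<le> real_vec m \<bullet> y}" by (auto simp: conic_def)
qed

lemma dual_monoid_cone: "dual_monoid (chart_cone i) = {m. \<forall>j. j \<noteq> i \<longrightarrow> 0 \<le> pairing m (column j P)}"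
proof (intro equalityI subsetI)
  fix m assume m: "m \<in> dual_monoid (chart_cone i)"
  have "0 \<le> real_vec m \<bullet> ray P j" if "j \<noteq> i" for j
    using m ray_in_cone[OF that] by (auto simp: dual_monoid_def)
  then show "m \<in> {m. \<forall>j. j \<noteq> i \<longrightarrow> 0 \<le> pairing m (column j P)}" by (simp add: inner_ray)
next
  fix m assume "m \<in> {m. \<forall>j. j \<noteq> i \<longrightarrow> 0 \<le> pairing m (column j P)}"
  then show "m \<in> dual_monoid (chart_cone i)" using cone_subset_halfspace[of i m] by (auto simp: dual_monoid_def)
qed

text \<open>A vector from \<open>dual\<close> is negative on ray \<open>i\<close> and nonnegative on
  all the others, so it separates ray \<open>i\<close> from the cone. Thus chart \<open>i\<close>
  meets every prime divisor except the one with index \<open>i\<close>.\<close>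

lemma ray_in_cone_iff: "ray P j \<in> chart_cone i \<longleftrightarrow> j \<noteq> i"
proof
  assume mem: "ray P j \<in> chart_cone i"
  show "j \<noteq> i"
  proof
    assume "j = i"
    obtain k where "k \<noteq> i" using ex_other_index[of i] by blast
    then obtain u where u: "0 < pairing u (column k P)" "pairing u (column i P) < 0"
        "\<forall>l. l \<noteq> i \<longrightarrow> l \<noteq> k \<longrightarrow> pairing u (column l P) = 0"
      using dual[of i k] by blast
    then have "chart_cone i \<subseteq> {y. 0 \<le> real_vec u \<bullet> y}"
      by (intro cone_subset_halfspace) (metis less_imp_le order_refl)
    then show False using mem u(2) \<open>j = i\<close> by (auto simp: inner_ray)
  qed
qed (rule ray_in_cone)

text \<open>If \<open>p + q = 0\<close>, the nonnegative pairings of \<open>p\<close> and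
  \<open>q\<close> with the columns other than \<open>i\<close> cancel, so they vanish, and these
  columns already detect zero.\<close>

lemma pointed_dual_monoid: "pointed_monoid (dual_monoid (chart_cone i))"
  unfolding pointed_monoid_def
proof (intro conjI ballI impI)
  fix p q assume pq: "p \<in> dual_monoid (chart_cone i)" "q \<in> dual_monoid (chart_cone i)"
  then show "p + q \<in> dual_monoid (chart_cone i)" by (simp add: dual_monoid_cone pairing_add_left)
  assume "p + q = 0"
  show "p = 0"
  proof (rule eq_0_if_pairing_eq_0)
    fix j assume "j \<noteq> i"
    then have "0 \<le> pairing p (column j P)" "0 \<le> pairing q (column j P)"
      using pq by (auto simp: dual_monoid_cone)
    moreover have "pairing p (column j P) + pairing q (column j P) = 0"
      using \<open>p + q = 0\<close> by (metis pairing_add_left pairing_zero_left)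
    ultimately show "pairing p (column j P) = 0" by linarith
  qed
qed (simp add: dual_monoid_cone)

section \<open>Characters among the sections of \<open>O(-D)\<close> and the local criterion for
  Cartier divisors\<close>

definition section_exponents :: "'m \<Rightarrow> int ^ 'm \<Rightarrow> (int ^ 'n) set" where
  "section_exponents i a = {m. \<forall>j. j \<noteq> i \<longrightarrow> a $ j \<le> pairing m (column j P)}"

text \<open>The order along a prime divisor is a minimum over exponents, so the condition on
  \<open>f\<close> is a condition on each exponent separately. The zero polynomial fits because it
  has no exponents.\<close>

lemma divisor_sections_cone:
  "divisor_sections P (chart_cone i) (- a) = {f. Poly_Mapping.keys f \<subseteq> section_exponents i a}"
proof -
  have "0 \<le> ord_along P j f + (- a) $ j \<longleftrightarrow>
      (\<forall>m\<in>Poly_Mapping.keys f. a $ j \<le> pairing m (column j P))" if "f \<noteq> 0" for f j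
  proof -
    have "Poly_Mapping.keys f \<noteq> {}" using that by simp
    moreover have "0 \<le> ord_along P j f + (- a) $ j \<longleftrightarrow> a $ j \<le> ord_along P j f" by simp
    ultimately show ?thesis by (simp add: ord_along_def Min_ge_iff del: vector_uminus_component)
  qed
  then have "f \<in> divisor_sections P (chart_cone i) (- a) \<longleftrightarrow> Poly_Mapping.keys f \<subseteq> section_exponents i a" for f
    unfolding divisor_sections_def section_exponents_def mem_Collect_eq ray_in_cone_iff
    by (cases "f = 0") auto
  then show ?thesis by blast
qed

text \<open>Primitivity of column \<open>j\<close> gives, by Bezout, some \<open>m\<^sub>0\<close>
  with the exact value \<open>a $ j\<close> there. The vector \<open>m\<^sub>1\<close> vanishes on
  column \<open>j\<close> and is positive on the columns other than \<open>i\<close> and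
  \<open>j\<close>, so a large multiple of it repairs the remaining inequalities.\<close>

lemma ex_section_exponent:
  assumes "j \<noteq> i"
  shows "\<exists>m\<in>section_exponents i a. pairing m (column j P) = a $ j"
proof -
  have "(GCD k\<in>UNIV. column j P $ k) = 1"
    using fwps by (simp add: fwps_matrix_def primitive_def)
  then obtain c where c: "(\<Sum>k\<in>UNIV. c k * column j P $ k) = 1"
    using bezout_Gcd_int[of UNIV "\<lambda>k. column j P $ k"] by auto
  define m\<^sub>0 where "m\<^sub>0 = a $ j *s (\<chi> k. c k)"
  have m0: "pairing m\<^sub>0 (column j P) = a $ j"
    using c unfolding m\<^sub>0_def pairing_scale_left by (simp add: pairing_def)
  have "\<forall>k. \<exists>u. k \<noteq> i \<longrightarrow> 0 < pairing u (column k P) \<and>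
      (\<forall>l. l \<noteq> i \<longrightarrow> l \<noteq> k \<longrightarrow> pairing u (column l P) = 0)"
    using dual[of i] by metis
  then obtain u where u: "\<And>k. k \<noteq> i \<Longrightarrow> 0 < pairing (u k) (column k P)"
      "\<And>k l. k \<noteq> i \<Longrightarrow> l \<noteq> i \<Longrightarrow> l \<noteq> k \<Longrightarrow> pairing (u k) (column l P) = 0"
    by metis
  define m\<^sub>1 where "m\<^sub>1 = (\<Sum>k\<in>- {i, j}. u k)"
  have m1: "pairing m\<^sub>1 (column l P) = (if l = j then 0 else pairing (u l) (column l P))" if "l \<noteq> i" for l
  proof -
    have "pairing m\<^sub>1 (column l P) = (\<Sum>k\<in>- {i, j}. pairing (u k) (column l P))"
      by (simp add: m\<^sub>1_def pairing_sum_left)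
    also have "\<dots> = (\<Sum>k\<in>- {i, j}. if k = l then pairing (u l) (column l P) else 0)"
      using that u(2) by (intro sum.cong) auto
    finally show ?thesis using that by simp
  qed
  \<comment> \<open>\<open>N\<close> bounds every deficit of \<open>m\<^sub>0\<close>. Positive
    pairings are integers, hence at least 1, so adding \<open>N *s m\<^sub>1\<close>
    suffices.\<close>
  define N where "N = (\<Sum>l\<in>UNIV. \<bar>a $ l - pairing m\<^sub>0 (column l P)\<bar>)"
  have N: "a $ l - pairing m\<^sub>0 (column l P) \<le> N" for l
    using member_le_sum[of l UNIV "\<lambda>l. \<bar>a $ l - pairing m\<^sub>0 (column l P)\<bar>"] by (simp add: N_def)
  have "0 \<le> N" by (simp add: N_def sum_nonneg)
  define m where "m = m\<^sub>0 + N *s m\<^sub>1"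
  have "a $ l \<le> pairing m (column l P)" if "l \<noteq> i" for l
  proof (cases "l = j")
    case False
    have "N * 1 \<le> N * pairing (u l) (column l P)"
      using u(1)[OF that] \<open>0 \<le> N\<close> by (intro mult_left_mono) auto
    then show ?thesis using N[of l] False that
      by (simp add: m_def pairing_add_left pairing_scale_left m1)
  qed (use that in \<open>simp add: m_def pairing_add_left pairing_scale_left m0 m1\<close>)
  moreover have "pairing m (column j P) = a $ j"
    using assms by (simp add: m_def pairing_add_left pairing_scale_left m0 m1)
  ultimately show ?thesis by (auto simp: section_exponents_def)
qed

text \<open>Among the exponents that are exact on column \<open>j\<close>, one with least total
  slack is minimal: any \<open>q\<close> below it is squeezed to the exact value on column
  \<open>j\<close>, so it competes in the same minimization.\<close>

lemma ex_minimal_section_exponent: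
  assumes "j \<noteq> i"
  shows "\<exists>m\<in>section_exponents i a. pairing m (column j P) = a $ j \<and>
    (\<forall>q\<in>section_exponents i a. m - q \<in> dual_monoid (chart_cone i) \<longrightarrow> q = m)"
proof -
  \<comment> \<open>The slacks of a section exponent are nonnegative, so \<open>nat\<close> loses
    nothing on \<open>section_exponents i a\<close> and gives access to a least value.\<close>
  define height where "height m = nat (\<Sum>l\<in>- {i}. pairing m (column l P) - a $ l)" for m
  define B where "B = {m \<in> section_exponents i a. pairing m (column j P) = a $ j}"
  have "\<exists>m. m \<in> B" using ex_section_exponent[OF assms] by (auto simp: B_def)
  then obtain m where m: "m \<in> B" "\<And>q. q \<in> B \<Longrightarrow> height m \<le> height q"
    using ex_has_least_nat[of "\<lambda>m. m \<in> B" _ height] by blast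
  have "q = m" if q: "q \<in> section_exponents i a" "m - q \<in> dual_monoid (chart_cone i)" for q
  proof -
    have le: "pairing q (column l P) \<le> pairing m (column l P)" if "l \<noteq> i" for l
      using q(2) that by (simp add: dual_monoid_cone pairing_diff_left)
    have "q \<in> B" using q(1) m(1) le[OF assms] assms by (force simp: B_def section_exponents_def)
    have nonneg: "0 \<le> (\<Sum>l\<in>- {i}. pairing r (column l P) - a $ l)" if "r \<in> section_exponents i a" for r
      using that by (intro sum_nonneg) (auto simp: section_exponents_def)
    have "(\<Sum>l\<in>- {i}. pairing m (column l P) - a $ l) \<le> (\<Sum>l\<in>- {i}. pairing q (column l P) - a $ l)"
      using m(2)[OF \<open>q \<in> B\<close>] nonneg q(1) by (auto simp: height_def nat_le_eq_zle)
    then have "(\<Sum>l\<in>- {i}. pairing (m - q) (column l P)) \<le> 0"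
      by (simp add: pairing_diff_left sum_subtractf)
    moreover have nn: "0 \<le> pairing (m - q) (column l P)" if "l \<in> - {i}" for l
      using q(2) that by (simp add: dual_monoid_cone)
    ultimately have "(\<Sum>l\<in>- {i}. pairing (m - q) (column l P)) = 0"
      by (meson antisym sum_nonneg)
    then have "pairing (m - q) (column l P) = 0" if "l \<noteq> i" for l
      using that nn by (subst (asm) sum_nonneg_eq_0_iff) auto
    then have "m - q = 0" by (rule eq_0_if_pairing_eq_0)
    then show "q = m" by simp
  qed
  then show ?thesis using m(1) by (auto simp: B_def)
qed

text \<open>For each \<open>j\<close> other than \<open>i\<close> there is a minimal exponent that
  is exact on column \<open>j\<close>. A local generator at the torus-fixed point makes all of these
  coincide, and the common exponent is exact on every column other than \<open>i\<close>.\<close>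

lemma cartier_imp_local_equation:
  assumes "cartier P a"
  shows "\<exists>u. \<forall>j. j \<noteq> i \<longrightarrow> pairing u (column j P) = a $ j"
proof -
  let ?S = "dual_monoid (chart_cone i)" and ?A = "section_exponents i a"
  \<comment> \<open>The torus-fixed point of the chart.\<close>
  define x :: "int ^ 'n \<Rightarrow> complex" where "x m = (if m = 0 then 1 else 0)" for m
  have "x (p + q) = x p * x q" if "p \<in> ?S" "q \<in> ?S" for p q
    using pointed_monoidD(3)[OF pointed_dual_monoid that] by (auto simp: x_def)
  then have "x \<in> chart_points (chart_cone i)" by (simp add: chart_points_def x_def)
  moreover have "chart_cone i \<in> maximal_cones P" by (simp add: maximal_cones_eq)
  ultimately have "\<exists>s\<in>chart_ring (chart_cone i). eval_at x s \<noteq> 0 \<and>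
      (\<exists>f\<in>divisor_sections P (chart_cone i) (- a). f \<noteq> 0 \<and>
        (\<forall>g\<in>divisor_sections P (chart_cone i) (- a). \<exists>k. \<exists>h\<in>chart_ring (chart_cone i). s ^ k * g = h * f))"
    using assms unfolding cartier_def by (elim ballE) auto
  then obtain s f where s: "s \<in> chart_ring (chart_cone i)" "eval_at x s \<noteq> 0"
    and f: "f \<in> divisor_sections P (chart_cone i) (- a)"
    and gen: "\<forall>g\<in>divisor_sections P (chart_cone i) (- a). \<exists>k. \<exists>h\<in>chart_ring (chart_cone i). s ^ k * g = h * f"
    by (elim bexE conjE) (rule that)
  \<comment> \<open>Evaluation at the fixed point reads off the constant term, so the localizing
    function \<open>s\<close> has a nonzero one.\<close>
  have "eval_at x s = (\<Sum>m\<in>Poly_Mapping.keys s. if m = 0 then Poly_Mapping.lookup s 0 else 0)"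
    unfolding eval_at_def x_def by (intro sum.cong) auto
  then have s0: "Poly_Mapping.lookup s 0 \<noteq> 0" using s(2) by (auto split: if_splits)
  have gen': "\<exists>k. \<exists>h. Poly_Mapping.keys h \<subseteq> ?S \<and> s ^ k * Poly_Mapping.single m 1 = h * f" if "m \<in> ?A" for m
  proof -
    have "Poly_Mapping.single m 1 \<in> divisor_sections P (chart_cone i) (- a)"
      using that by (simp add: divisor_sections_cone)
    from bspec[OF gen this] show ?thesis unfolding chart_ring_def mem_Collect_eq by blast
  qed
  have "\<forall>j\<in>- {i}. \<exists>m. m \<in> ?A \<and> pairing m (column j P) = a $ j \<and> (\<forall>q\<in>?A. m - q \<in> ?S \<longrightarrow> q = m)"
    (is "\<forall>j\<in>_. \<exists>m. ?Q j m")
  proof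
    fix j assume "j \<in> - {i}"
    then have "\<exists>m\<in>?A. pairing m (column j P) = a $ j \<and> (\<forall>q\<in>?A. m - q \<in> ?S \<longrightarrow> q = m)"
      by (intro ex_minimal_section_exponent) simp
    then show "\<exists>m. ?Q j m" by (simp only: Bex_def)
  qed
  then obtain m where Q: "\<forall>j\<in>- {i}. ?Q j (m j)" using bchoice[of "- {i}" ?Q] by auto
  have m: "m j \<in> ?A" "pairing (m j) (column j P) = a $ j"
      "\<And>q. q \<in> ?A \<Longrightarrow> m j - q \<in> ?S \<Longrightarrow> q = m j" if "j \<noteq> i" for j
    using bspec[OF Q, of j] that by simp_all
  obtain j\<^sub>0 where j0: "j\<^sub>0 \<noteq> i" using ex_other_index by blast
  have "m j = m j\<^sub>0" if j: "j \<noteq> i" for j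
  proof -
    obtain k\<^sub>1 h\<^sub>1 where "Poly_Mapping.keys h\<^sub>1 \<subseteq> ?S" "s ^ k\<^sub>1 * Poly_Mapping.single (m j) 1 = h\<^sub>1 * f"
      using gen'[OF m(1)[OF j]] by blast
    moreover obtain k\<^sub>2 h\<^sub>2 where "Poly_Mapping.keys h\<^sub>2 \<subseteq> ?S" "s ^ k\<^sub>2 * Poly_Mapping.single (m j\<^sub>0) 1 = h\<^sub>2 * f"
      using gen'[OF m(1)[OF j0]] by blast
    ultimately show ?thesis
      using minimal_exponent_unique[OF pointed_dual_monoid, of f ?A s i h\<^sub>1 h\<^sub>2 k\<^sub>1 "m j" k\<^sub>2 "m j\<^sub>0"]
        s(1) s0 f m(1)[OF j0] m(3)[OF j] m(3)[OF j0]
      by (simp add: chart_ring_def divisor_sections_cone)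
  qed
  then have "pairing (m j\<^sub>0) (column j P) = a $ j" if "j \<noteq> i" for j
    using m(2) that by metis
  then show ?thesis by blast
qed

text \<open>The character of \<open>u\<close> generates \<open>O(-D)\<close> over the whole chart:
  dividing a section by it shifts the exponents by \<open>- u\<close> into the dual monoid. So no
  localization is required and \<open>s = 1\<close> serves at every point.\<close>

lemma cartier_if_local_equations:
  assumes "\<And>i. \<exists>u. \<forall>j. j \<noteq> i \<longrightarrow> pairing u (column j P) = a $ j"
  shows "cartier P a"
  unfolding cartier_def
proof (intro ballI)
  fix \<sigma> x assume "\<sigma> \<in> maximal_cones P" and x: "x \<in> chart_points \<sigma>"
  then obtain i where \<sigma>: "\<sigma> = chart_cone i" by (auto simp: maximal_cones_eq)
  obtain u where u: "\<And>j. j \<noteq> i \<Longrightarrow> pairing u (column j P) = a $ j" using assms by blast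
  define f :: "'n laurent" where "f = Poly_Mapping.single u 1"
  have eval: "eval_at x 1 \<noteq> 0" using x by (simp add: eval_at_def chart_points_def)
  have one: "1 \<in> chart_ring \<sigma>" by (simp add: chart_ring_def \<sigma> dual_monoid_cone)
  have f_section: "f \<in> divisor_sections P \<sigma> (- a)"
    by (simp add: \<sigma> divisor_sections_cone section_exponents_def f_def u)
  have "Poly_Mapping.lookup f u \<noteq> 0" by (simp add: f_def)
  then have nz: "f \<noteq> 0" by auto
  have gen: "\<exists>k. \<exists>h\<in>chart_ring \<sigma>. 1 ^ k * g = h * f" if g: "g \<in> divisor_sections P \<sigma> (- a)" for g
  proof (intro exI bexI)
    let ?h = "g * Poly_Mapping.single (- u) 1"
    show "1 ^ 0 * g = ?h * f" by (simp add: f_def mult.assoc mult_single)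
    show "?h \<in> chart_ring \<sigma>"
    proof -
      have "m \<in> dual_monoid \<sigma>" if m: "m \<in> Poly_Mapping.keys ?h" for m
      proof -
        obtain q where q: "q \<in> Poly_Mapping.keys g" "m = q - u"
          using subsetD[OF keys_mult m] by auto
        then have "q \<in> section_exponents i a" using g by (auto simp: \<sigma> divisor_sections_cone)
        then show ?thesis using u q(2) by (simp add: \<sigma> dual_monoid_cone section_exponents_def pairing_diff_left)
      qed
      then show ?thesis by (auto simp: chart_ring_def)
    qed
  qed
  show "\<exists>s\<in>chart_ring \<sigma>. eval_at x s \<noteq> 0 \<and> (\<exists>f\<in>divisor_sections P \<sigma> (- a). f \<noteq> 0 \<and>
      (\<forall>g\<in>divisor_sections P \<sigma> (- a). \<exists>k. \<exists>h\<in>chart_ring \<sigma>. s ^ k * g = h * f))"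
  proof (rule bexI[of _ 1])
    have "\<forall>g\<in>divisor_sections P \<sigma> (- a). \<exists>k. \<exists>h\<in>chart_ring \<sigma>. 1 ^ k * g = h * f"
      using gen by (intro ballI)
    then show "eval_at x 1 \<noteq> 0 \<and> (\<exists>f\<in>divisor_sections P \<sigma> (- a). f \<noteq> 0 \<and>
        (\<forall>g\<in>divisor_sections P \<sigma> (- a). \<exists>k. \<exists>h\<in>chart_ring \<sigma>. 1 ^ k * g = h * f))"
      using eval f_section nz by (intro conjI bexI[of _ f])
  qed (rule one)
qed

lemma cartier_iff: "cartier P a \<longleftrightarrow> (\<forall>i. \<exists>u. \<forall>j. j \<noteq> i \<longrightarrow> pairing u (column j P) = a $ j)"
proof
  assume "cartier P a"
  then show "\<forall>i. \<exists>u. \<forall>j. j \<noteq> i \<longrightarrow> pairing u (column j P) = a $ j"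
    by (intro allI) (rule cartier_imp_local_equation)
next
  assume "\<forall>i. \<exists>u. \<forall>j. j \<noteq> i \<longrightarrow> pairing u (column j P) = a $ j"
  from cartier_if_local_equations[OF spec[OF this]] show "cartier P a" .
qed

end

section \<open>Arithmetic of the weights and the class group\<close>

text \<open>The number \<open>a div gcd a b\<close> is the additive order of \<open>b\<close> modulo
  \<open>a\<close>; after cancelling the gcd, the cofactors are coprime.\<close>

lemma dvd_mult_iff_div_gcd_dvd:
  fixes a b m :: nat
  assumes "0 < a"
  shows "a dvd m * b \<longleftrightarrow> a div gcd a b dvd m"
proof -
  obtain a' b' where ab: "a = a' * gcd a b" "b = b' * gcd a b" "coprime a' b'"
    using gcd_coprime_exists[of a b] assms by auto
  define g where "g = gcd a b"
  have g: "g \<noteq> 0" "a = a' * g" "b = b' * g" using assms ab(1,2) by (simp_all add: g_def)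
  have "a dvd m * b \<longleftrightarrow> a' * g dvd (m * b') * g" by (simp add: g(2,3) mult.assoc)
  also have "\<dots> \<longleftrightarrow> a' dvd m" using g(1) ab(3) by (simp add: coprime_dvd_mult_left_iff)
  also have "a' = a div g" using g(1) by (simp add: g(2))
  finally show ?thesis by (simp add: g_def)
qed

lemma dvd_mult_GCD_iff:
  fixes a m :: nat
  shows "a dvd m * (GCD i\<in>I. f i) \<longleftrightarrow> (\<forall>i\<in>I. a dvd m * f i)"
proof -
  have "m * (GCD i\<in>I. f i) = (GCD i\<in>I. m * f i)"
    using Gcd_mult[of m "f ` I"] by (simp add: image_image)
  then show ?thesis by (simp add: dvd_Gcd_iff)
qed

lemma div_gcd_pos: "0 < a \<Longrightarrow> 0 < a div gcd a b" for a b :: nat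
  by (simp add: div_greater_zero_iff)

text \<open>Divisibility by all weights means \<open>N = L * m\<close>, and then each
  \<open>c\<close> is determined as \<open>m * (L div w i)\<close>. The remaining conditions say
  that \<open>m\<close> times each \<open>L div w i * \<eta> i j\<close> vanishes modulo
  \<open>\<mu> j\<close>; by the order criterion and the lcm they combine into one divisibility of
  \<open>m\<close>.\<close>

lemma common_multiple_iff:
  fixes w :: "'m::finite \<Rightarrow> nat" and \<mu> :: "'j \<Rightarrow> nat" and \<eta> :: "'m \<Rightarrow> 'j \<Rightarrow> nat" and N :: int
  defines "L \<equiv> LCM i\<in>UNIV. w i"
  assumes w: "\<And>i. 0 < w i" and \<mu>: "\<And>j. j \<in> J \<Longrightarrow> 0 < \<mu> j"
  shows "(\<forall>i. \<exists>c. N = c * int (w i) \<and> (\<forall>j\<in>J. int (\<mu> j) dvd c * int (\<eta> i j))) \<longleftrightarrow>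
    int (L * (LCM j\<in>J. \<mu> j div gcd (\<mu> j) (GCD i\<in>UNIV. L div w i * \<eta> i j))) dvd N"
    (is "?lhs \<longleftrightarrow> int (L * ?M) dvd N")
proof -
  have wL: "w i dvd L" for i by (simp add: L_def dvd_Lcm)
  have M: "?M dvd m \<longleftrightarrow> (\<forall>i. \<forall>j\<in>J. \<mu> j dvd m * (L div w i * \<eta> i j))" for m
  proof -
    have "?M dvd m \<longleftrightarrow> (\<forall>j\<in>J. \<mu> j div gcd (\<mu> j) (GCD i\<in>UNIV. L div w i * \<eta> i j) dvd m)"
      by (simp add: Lcm_dvd_iff)
    also have "\<dots> \<longleftrightarrow> (\<forall>j\<in>J. \<mu> j dvd m * (GCD i\<in>UNIV. L div w i * \<eta> i j))"
      using \<mu> by (simp add: dvd_mult_iff_div_gcd_dvd)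
    finally show ?thesis by (auto simp: dvd_mult_GCD_iff)
  qed
  \<comment> \<open>Degrees may be negative, so the criterion is carried from natural numbers to
    integers through absolute values.\<close>
  have M_int: "int ?M dvd m \<longleftrightarrow> (\<forall>i. \<forall>j\<in>J. int (\<mu> j) dvd m * int (L div w i) * int (\<eta> i j))" for m
  proof -
    have "x dvd nat \<bar>m\<bar> * y \<longleftrightarrow> int x dvd m * int y" for x y
      using dvd_nat_abs_iff[of x "m * int y"] by (simp add: nat_abs_mult_distrib)
    then show ?thesis using M[of "nat \<bar>m\<bar>"] dvd_nat_abs_iff[of ?M m] by (simp add: mult.assoc)
  qed
  have L_eq: "int (L div w i) * int (w i) = int L" for i
    using wL[of i] by (metis dvd_div_mult_self of_nat_mult)
  have c_eq: "c = m * int (L div w i)" if "int L * m = c * int (w i)" for c m i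
  proof -
    have "c * int (w i) = (m * int (L div w i)) * int (w i)"
      unfolding mult.assoc L_eq using that by (simp only: mult.commute)
    then show ?thesis using w[of i] by simp
  qed
  show ?thesis
  proof
    assume lhs: ?lhs
    then have "w i dvd nat \<bar>N\<bar>" for i by (metis dvd_triv_right dvd_nat_abs_iff)
    then have "L dvd nat \<bar>N\<bar>" unfolding L_def by (intro Lcm_least) blast
    then obtain m where m: "N = int L * m" by (metis dvd_nat_abs_iff dvdE)
    have "int (\<mu> j) dvd m * int (L div w i) * int (\<eta> i j)" if "j \<in> J" for i j
      using lhs that c_eq unfolding m by metis
    then have "int ?M dvd m" using M_int by blast
    then show "int (L * ?M) dvd N" by (simp add: m)
  next
    assume "int (L * ?M) dvd N"
    then obtain t where "N = int (L * ?M) * t" by (elim dvdE)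
    then have t: "N = int L * (int ?M * t)" by (simp only: of_nat_mult mult.assoc)
    define m where "m = int ?M * t"
    have "int ?M dvd m" by (simp add: m_def)
    then have "int (\<mu> j) dvd m * int (L div w i) * int (\<eta> i j)" if "j \<in> J" for i j
      using M_int that by blast
    moreover have "N = m * int (L div w i) * int (w i)" for i
      unfolding mult.assoc L_eq t m_def by (simp only: ac_simps)
    ultimately show ?lhs by blast
  qed
qed

section \<open>The divisor class group as a quotient\<close>

lemma comm_group_divisor_group: "comm_group divisor_group"
proof (rule comm_groupI)
  show "\<exists>y\<in>carrier divisor_group. y \<otimes>\<^bsub>divisor_group\<^esub> x = \<one>\<^bsub>divisor_group\<^esub>" for x
    by (auto simp: divisor_group_def intro!: exI[of _ "- x"])
qed (auto simp: divisor_group_def)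

lemma inv_divisor_group: "inv\<^bsub>divisor_group\<^esub> x = - x"
  using comm_group_divisor_group
  by (intro group.inv_equality) (auto simp: divisor_group_def comm_group_def)

lemma subgroup_principal_divisors: "subgroup (principal_divisors P) divisor_group"
proof (rule group.subgroupI)
  show "group divisor_group" using comm_group_divisor_group comm_group_def by blast
  show "principal_divisors P \<noteq> {}" by (simp add: principal_divisors_def)
  fix a assume "a \<in> principal_divisors P"
  then obtain u where u: "a = transpose P *v u" by (auto simp: principal_divisors_def)
  have "- a = transpose P *v (- u)"
    by (simp add: u vec_eq_iff matrix_vector_mult_def sum_negf)
  then show "inv\<^bsub>divisor_group\<^esub> a \<in> principal_divisors P"
    by (simp add: inv_divisor_group principal_divisors_def)
  fix b assume "b \<in> principal_divisors P"
  then obtain v where "b = transpose P *v v" by (auto simp: principal_divisors_def)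
  then have "a + b = transpose P *v (u + v)"
    by (simp add: u vec_eq_iff matrix_vector_mult_def sum.distrib algebra_simps)
  then show "a \<otimes>\<^bsub>divisor_group\<^esub> b \<in> principal_divisors P"
    by (simp add: divisor_group_def principal_divisors_def)
qed (simp add: divisor_group_def)

lemma divisor_class_eq: "divisor_class P a = (\<lambda>d. d + a) ` principal_divisors P"
  by (auto simp: divisor_class_def r_coset_def divisor_group_def)

lemma divisor_class_eq_iff:
  fixes P :: "int ^ 'm ^ 'n"
  shows "divisor_class P a = divisor_class P b \<longleftrightarrow> a - b \<in> principal_divisors P"
proof -
  have group: "group (divisor_group :: (int ^ 'm) monoid)"
    using comm_group_divisor_group comm_group_def by blast
  have carrier: "x \<in> carrier divisor_group" for x :: "int ^ 'm" by (simp add: divisor_group_def)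
  have "a \<in> divisor_class P a"
    unfolding divisor_class_def by (intro group.rcos_self group carrier subgroup_principal_divisors)
  moreover have "divisor_class P b = divisor_class P a" if "a \<in> divisor_class P b"
    using that unfolding divisor_class_def
    by (intro group.repr_independence group carrier subgroup_principal_divisors)
  ultimately have "divisor_class P a = divisor_class P b \<longleftrightarrow> a \<in> divisor_class P b" by blast
  also have "\<dots> \<longleftrightarrow> a - b \<in> principal_divisors P"
    unfolding divisor_class_eq by (force simp: image_iff)
  finally show ?thesis .
qed

lemma divisor_class_hom: "divisor_class P \<in> hom divisor_group (class_group P)"
proof -
  have "principal_divisors P \<lhd> divisor_group"
    by (intro comm_group.subgroup_imp_normal comm_group_divisor_group subgroup_principal_divisors)
  then show ?thesis
    using normal.r_coset_hom_Mod unfolding class_group_def divisor_class_def[abs_def] by blast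
qed

lemma carrier_class_group: "carrier (class_group P) = range (divisor_class P)"
  by (auto simp: class_group_def FactGroup_def RCOSETS_def divisor_class_def divisor_group_def)

lemma group_grading_group: "group (grading_group r \<mu>)"
  unfolding grading_group_def by (intro DirProd_group) auto

lemma carrier_grading_group:
  "carrier (grading_group r \<mu>) = UNIV \<times> (\<Pi>\<^sub>E j\<in>{1..r}. carrier (integer_mod_group (\<mu> j)))"
  by (simp add: grading_group_def)

section \<open>The Picard group and the Gorenstein index\<close>

lemma sum_axis_mult: "(\<Sum>k\<in>UNIV. axis i c $ k * f k) = c * f i" for c :: "'a::semiring_0"
proof -
  have "(\<Sum>k\<in>UNIV. axis i c $ k * f k) = (\<Sum>k\<in>UNIV. if k = i then c * f i else 0)"
    by (intro sum.cong) (auto simp: axis_def)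
  then show ?thesis by simp
qed

locale graded_fan =
  fixes P :: "int ^ 'm ^ 'n" and r :: nat and \<mu> :: "nat \<Rightarrow> nat"
    and \<Phi> :: "(int ^ 'm) set \<Rightarrow> int \<times> (nat \<Rightarrow> int)"
    and w :: "'m \<Rightarrow> nat" and \<eta> :: "'m \<Rightarrow> nat \<Rightarrow> nat"
  assumes fwps: "fwps_matrix P"
    and mu_pos: "j \<in> {1..r} \<Longrightarrow> 1 \<le> \<mu> j"
    and iso: "\<Phi> \<in> iso (class_group P) (grading_group r \<mu>)"
    and w_pos: "1 \<le> w i"
    and class_prime_divisor:
      "\<Phi> (divisor_class P (prime_divisor i)) = (int (w i), \<lambda>j\<in>{1..r}. int (\<eta> i j))"
begin

section \<open>Degree and torsion coordinates of divisor classes\<close>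

definition degree :: "int ^ 'm \<Rightarrow> int" where
  "degree a = (\<Sum>i\<in>UNIV. a $ i * int (w i))"

text \<open>An unreduced integer lift of the component in the \<open>j\<close>-th cyclic factor;
  left unreduced, it is linear in the divisor.\<close>

definition torsion :: "nat \<Rightarrow> int ^ 'm \<Rightarrow> int" where
  "torsion j a = (\<Sum>i\<in>UNIV. a $ i * int (\<eta> i j))"

lemma degree_simps [simp]:
  "degree 0 = 0" "degree (a - b) = degree a - degree b" "degree (axis i c) = c * int (w i)"
  by (simp_all add: degree_def sum_axis_mult left_diff_distrib sum_subtractf)

lemma torsion_simps [simp]:
  "torsion j 0 = 0" "torsion j (a - b) = torsion j a - torsion j b" "torsion j (axis i c) = c * int (\<eta> i j)"
  by (simp_all add: torsion_def sum_axis_mult left_diff_distrib sum_subtractf)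

definition grading :: "int ^ 'm \<Rightarrow> int \<times> (nat \<Rightarrow> int)" where
  "grading a = \<Phi> (divisor_class P a)"

lemma grading_hom: "grading \<in> hom divisor_group (grading_group r \<mu>)"
proof -
  have "\<Phi> \<in> hom (class_group P) (grading_group r \<mu>)" using iso by (simp add: iso_def)
  from hom_compose[OF divisor_class_hom this] show ?thesis by (simp add: grading_def[abs_def] comp_def)
qed

lemma grading_add: "grading (a + b) = grading a \<otimes>\<^bsub>grading_group r \<mu>\<^esub> grading b"
  using grading_hom by (auto simp: hom_def divisor_group_def)

lemma range_grading: "range grading = carrier (grading_group r \<mu>)"
proof -
  have "bij_betw \<Phi> (carrier (class_group P)) (carrier (grading_group r \<mu>))" using iso by (simp add: iso_def)
  then have "\<Phi> ` range (divisor_class P) = carrier (grading_group r \<mu>)"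
    by (simp add: bij_betw_def carrier_class_group)
  then show ?thesis by (simp add: grading_def[abs_def] image_image)
qed

text \<open>A homomorphism on the divisor group is determined by the prime divisors, whose images
  are given.\<close>

lemma grading_eq: "grading a = (degree a, \<lambda>j\<in>{1..r}. torsion j a mod int (\<mu> j))"
proof -
  have mem: "snd (grading a) \<in> (\<Pi>\<^sub>E j\<in>{1..r}. carrier (integer_mod_group (\<mu> j)))" for a
    using range_grading unfolding carrier_grading_group by (metis mem_Times_iff rangeI)
  have axis: "grading (axis i 1) = (int (w i), \<lambda>j\<in>{1..r}. int (\<eta> i j))" for i
    using class_prime_divisor by (simp add: grading_def prime_divisor_def)
  have "[fst (grading a) = (\<Sum>i\<in>UNIV. a $ i * fst (grading (axis i 1)))] (mod 0)"
    by (rule additive_int_vec_cong)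
      (simp add: grading_add grading_group_def DirProd_def split_beta)
  then have fst: "fst (grading a) = degree a" by (simp add: axis degree_def)
  have snd: "snd (grading a) j = torsion j a mod int (\<mu> j)" if j: "j \<in> {1..r}" for j
  proof -
    have "[snd (grading a) j = (\<Sum>i\<in>UNIV. a $ i * snd (grading (axis i 1)) j)] (mod int (\<mu> j))"
      using j by (intro additive_int_vec_cong[where f = "\<lambda>a. snd (grading a) j"])
        (simp add: grading_add grading_group_def DirProd_def split_beta cong_def)
    then have "[snd (grading a) j = torsion j a] (mod int (\<mu> j))" using j by (simp add: axis torsion_def)
    \<comment> \<open>Lying in the carrier makes the component the reduced representative, so the
      congruence becomes an equality with the remainder.\<close>
    moreover have "snd (grading a) j \<in> {0..<int (\<mu> j)}"
      using mem[of a] j mu_pos[OF j] by (auto simp: carrier_integer_mod_group dest!: PiE_mem)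
    ultimately show ?thesis by (simp add: cong_def)
  qed
  have "snd (grading a) = (\<lambda>j\<in>{1..r}. torsion j a mod int (\<mu> j))"
  proof
    fix j show "snd (grading a) j = (\<lambda>j\<in>{1..r}. torsion j a mod int (\<mu> j)) j"
      using snd mem[of a] PiE_arb by (cases "j \<in> {1..r}") fastforce+
  qed
  then show ?thesis using fst by (metis prod.collapse)
qed

lemma grading_eq_iff:
  "grading a = grading b \<longleftrightarrow> degree a = degree b \<and> (\<forall>j\<in>{1..r}. int (\<mu> j) dvd torsion j a - torsion j b)"
  by (auto simp: grading_eq restrict_def fun_eq_iff mod_eq_dvd_iff)

text \<open>Since \<Phi> is injective on classes, the principal divisors are exactly the kernel of
  \<open>grading\<close>.\<close>

lemma principal_iff:
  "a \<in> principal_divisors P \<longleftrightarrow> degree a = 0 \<and> (\<forall>j\<in>{1..r}. int (\<mu> j) dvd torsion j a)"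
proof -
  have "inj_on \<Phi> (range (divisor_class P))"
    using iso unfolding iso_def bij_betw_def carrier_class_group by blast
  then have "divisor_class P a = divisor_class P 0 \<longleftrightarrow> grading a = grading 0"
    unfolding grading_def by (metis inj_on_eq_iff rangeI)
  then show ?thesis using divisor_class_eq_iff[of P a 0] grading_eq_iff[of a 0] by simp
qed

text \<open>The product of the \<open>\<mu>\<^sub>j\<close> kills the torsion component of the class of \<open>w\<^sub>i D\<^sub>k - w\<^sub>k D\<^sub>i\<close>, so a
  multiple of this divisor is the divisor of a character.\<close>

sublocale weighted_fan P w
proof
  show "fwps_matrix P" by (rule fwps)
  show "1 \<le> w i" for i by (rule w_pos)
  show "(\<Sum>k\<in>UNIV. int (w k) * pairing u (column k P)) = 0" for u
  proof -
    have "transpose P *v u \<in> principal_divisors P" by (simp add: principal_divisors_def)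
    then have "degree (transpose P *v u) = 0" by (simp add: principal_iff)
    then show ?thesis by (simp add: degree_def vector_matrix_mult_nth mult.commute)
  qed
  fix i k :: 'm assume "i \<noteq> k"
  define T where "T = (\<Prod>j\<in>{1..r}. int (\<mu> j))"
  have "0 < T" using mu_pos by (auto simp: T_def intro!: prod_pos) (metis atLeastAtMost_iff less_le_trans zero_less_one One_nat_def)
  have "int (\<mu> j) dvd T" if "j \<in> {1..r}" for j unfolding T_def using that by (intro dvd_prodI) auto
  then have "axis k (T * int (w i)) - axis i (T * int (w k)) \<in> principal_divisors P"
    by (simp add: principal_iff)
  then obtain u where u: "axis k (T * int (w i)) - axis i (T * int (w k)) = transpose P *v u"
    by (auto simp: principal_divisors_def)
  have "pairing u (column l P) = (axis k (T * int (w i)) - axis i (T * int (w k))) $ l" for l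
    by (simp only: u transpose_matrix_vector vector_matrix_mult_nth)
  moreover have "0 < T * int (w l)" for l using \<open>0 < T\<close> w_pos[of l] by simp
  ultimately show "\<exists>u. 0 < pairing u (column k P) \<and> pairing u (column i P) < 0 \<and>
      (\<forall>l. l \<noteq> i \<longrightarrow> l \<noteq> k \<longrightarrow> pairing u (column l P) = 0)"
    using \<open>i \<noteq> k\<close> by (intro exI[of _ u]) (simp add: axis_def)
qed

text \<open>A character that agrees with \<open>a\<close> away from index \<open>i\<close> differs
  from it by a multiple \<open>c\<close> of the \<open>i\<close>-th prime divisor. So a local
  equation on chart \<open>i\<close> exists iff the class of \<open>a\<close> is \<open>c\<close>
  times the class of that divisor.\<close>

lemma cartier_iff_classes:
  "cartier P a \<longleftrightarrow> (\<forall>i. \<exists>c. degree a = c * int (w i) \<and>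
      (\<forall>j\<in>{1..r}. int (\<mu> j) dvd torsion j a - c * int (\<eta> i j)))"
proof -
  have "(\<exists>u. \<forall>j. j \<noteq> i \<longrightarrow> pairing u (column j P) = a $ j) \<longleftrightarrow>
      (\<exists>c. a - axis i c \<in> principal_divisors P)" for i
  proof
    assume "\<exists>u. \<forall>j. j \<noteq> i \<longrightarrow> pairing u (column j P) = a $ j"
    then obtain u where "\<forall>j. j \<noteq> i \<longrightarrow> pairing u (column j P) = a $ j" by blast
    then have "a - axis i (a $ i - pairing u (column i P)) = transpose P *v u"
      by (auto simp: vec_eq_iff vector_matrix_mult_nth axis_def)
    then show "\<exists>c. a - axis i c \<in> principal_divisors P" by (metis principal_divisors_def rangeI)
  next
    assume "\<exists>c. a - axis i c \<in> principal_divisors P"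
    then obtain c u where "a - axis i c = transpose P *v u" by (auto simp: principal_divisors_def)
    then have "pairing u (column j P) = (a - axis i c) $ j" for j by (simp add: vector_matrix_mult_nth)
    then show "\<exists>u. \<forall>j. j \<noteq> i \<longrightarrow> pairing u (column j P) = a $ j" by (intro exI[of _ u]) (simp add: axis_def)
  qed
  then show ?thesis by (simp add: cartier_iff principal_iff)
qed

definition L where "L = (LCM i\<in>UNIV. w i)"

definition M where "M = (LCM j\<in>{1..r}. \<mu> j div gcd (\<mu> j) (GCD i\<in>UNIV. L div w i * \<eta> i j))"

lemma cartier_iff_dvd:
  "cartier P a \<longleftrightarrow> int (L * M) dvd degree a \<and> (\<forall>j\<in>{1..r}. int (\<mu> j) dvd torsion j a)"
proof -
  have *: "(\<forall>i. \<exists>c. degree a = c * int (w i) \<and> (\<forall>j\<in>{1..r}. int (\<mu> j) dvd c * int (\<eta> i j))) \<longleftrightarrow>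
      int (L * M) dvd degree a"
    unfolding L_def M_def using w_pos mu_pos
    by (intro common_multiple_iff) (auto simp: Suc_le_eq)
  have torsion_free: "int (\<mu> j) dvd torsion j a" if a: "cartier P a" and j: "j \<in> {1..r}" for j
  proof -
    have "(1, \<lambda>j\<in>{1..r}. 0) \<in> carrier (grading_group r \<mu>)"
      by (auto simp: carrier_grading_group)
    then obtain b where "grading b = (1, \<lambda>j\<in>{1..r}. 0)" using range_grading by (metis imageE)
    then have "degree b = 1" and "(\<lambda>j\<in>{1..r}. torsion j b mod int (\<mu> j)) j = (\<lambda>j\<in>{1..r}. 0) j"
      by (simp_all add: grading_eq)
    then have b: "degree b = 1" "int (\<mu> j) dvd torsion j b" using j by (auto simp: dvd_eq_mod_eq_0)
    have "\<forall>i. \<exists>c. degree a = c * int (w i) \<and> int (\<mu> j) dvd torsion j a - c * int (\<eta> i j)"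
      using a j unfolding cartier_iff_classes by blast
    then obtain c where c: "\<And>i. degree a = c i * int (w i)"
        "\<And>i. int (\<mu> j) dvd torsion j a - c i * int (\<eta> i j)"
      by metis
    \<comment> \<open>The class of \<open>b\<close> is \<open>(1, 0)\<close>, and expanding \<open>1 = degree b\<close> turns the torsion part of \<open>a\<close>
      into a multiple of that of \<open>b\<close>.\<close>
    have "torsion j a = (\<Sum>i\<in>UNIV. b $ i * int (w i) * torsion j a)"
      using b(1) by (simp add: degree_def flip: sum_distrib_right)
    moreover have expand: "degree a * (b $ i * int (\<eta> i j)) = b $ i * int (w i) * (c i * int (\<eta> i j))" for i
      unfolding c(1)[of i] by (simp only: ac_simps)
    have "degree a * torsion j b = (\<Sum>i\<in>UNIV. b $ i * int (w i) * (c i * int (\<eta> i j)))"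
      by (simp only: torsion_def sum_distrib_left expand)
    ultimately have "torsion j a - degree a * torsion j b =
        (\<Sum>i\<in>UNIV. b $ i * int (w i) * (torsion j a - c i * int (\<eta> i j)))"
      by (simp add: right_diff_distrib sum_subtractf)
    also have "int (\<mu> j) dvd \<dots>" using c(2) by (intro dvd_sum dvd_mult)
    finally have "int (\<mu> j) dvd torsion j a - degree a * torsion j b" .
    then show ?thesis using b(2) by (metis dvd_add diff_add_cancel dvd_mult)
  qed
  \<comment> \<open>With trivial torsion, the term \<open>torsion j a\<close> drops out of each
    congruence, and the condition of \<open>common_multiple_iff\<close> remains.\<close>
  have "cartier P a \<longleftrightarrow> int (L * M) dvd degree a" if "\<forall>j\<in>{1..r}. int (\<mu> j) dvd torsion j a"
    unfolding *[symmetric] cartier_iff_classes using that by (simp add: dvd_diff_right_iff)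
  then show ?thesis using torsion_free by blast
qed

text \<open>One inclusion reads off coordinates; for the other, surjectivity of
  \<open>grading\<close> supplies a divisor with the prescribed coordinates, and
  \<open>cartier_iff_dvd\<close> recognizes it as Cartier.\<close>

lemma image_picard_group: "\<Phi> ` picard_group P = range (\<lambda>t. (int (L * M) * t, \<lambda>j\<in>{1..r}. 0))"
proof -
  have "\<Phi> ` picard_group P = grading ` {a. cartier P a}"
    by (simp add: picard_group_def grading_def[abs_def] image_image)
  also have "\<dots> = range (\<lambda>t. (int (L * M) * t, \<lambda>j\<in>{1..r}. 0))"
  proof (intro equalityI subsetI)
    fix z assume "z \<in> grading ` {a. cartier P a}"
    then obtain a where a: "z = grading a" "cartier P a" by auto
    then obtain t where "degree a = int (L * M) * t" by (auto simp: cartier_iff_dvd)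
    moreover have "(\<lambda>j\<in>{1..r}. torsion j a mod int (\<mu> j)) = (\<lambda>j\<in>{1..r}. 0)"
      using a(2) unfolding cartier_iff_dvd by (intro restrict_ext) auto
    ultimately show "z \<in> range (\<lambda>t. (int (L * M) * t, \<lambda>j\<in>{1..r}. 0))"
      unfolding a(1) grading_eq by (intro range_eqI[of _ _ t]) simp
  next
    fix z assume "z \<in> range (\<lambda>t. (int (L * M) * t, \<lambda>j\<in>{1..r}. 0::int))"
    then obtain t where z: "z = (int (L * M) * t, \<lambda>j\<in>{1..r}. 0)" by blast
    then have "z \<in> carrier (grading_group r \<mu>)" by (auto simp: carrier_grading_group)
    then obtain a where a: "z = grading a" using range_grading by (metis imageE)
    have "degree a = int (L * M) * t" "int (\<mu> j) dvd torsion j a" if "j \<in> {1..r}" for j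
    proof -
      show "degree a = int (L * M) * t" using a z by (simp add: grading_eq)
      have "(\<lambda>j\<in>{1..r}. torsion j a mod int (\<mu> j)) j = (\<lambda>j\<in>{1..r}. 0) j"
        using a z by (simp add: grading_eq)
      then show "int (\<mu> j) dvd torsion j a" using that by (auto simp: dvd_eq_mod_eq_0)
    qed
    \<comment> \<open>The degree is recorded again without an index, because \<open>{1..r}\<close>
      is empty when \<open>r = 0\<close>.\<close>
    moreover have "degree a = int (L * M) * t" using a z by (simp add: grading_eq)
    ultimately have "cartier P a" unfolding cartier_iff_dvd by (metis dvd_triv_left)
    then show "z \<in> grading ` {a. cartier P a}" using a by blast
  qed
  finally show ?thesis .
qed

end

text \<open>The map \<open>?h\<close> is a homomorphism from the integers, so its value at
  \<open>t\<close> is the \<open>t\<close>-th power of its value at 1, and a cyclic subgroup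
  consists of the powers of its generator.\<close>

lemma generate_degree:
  "generate (grading_group r \<mu>) {(d, \<lambda>j\<in>{1..r}. 0)} = range (\<lambda>t. (d * t, \<lambda>j\<in>{1..r}. 0))"
proof -
  let ?G = "grading_group r \<mu>" and ?h = "\<lambda>t. (d * t, \<lambda>j\<in>{1..r}. 0::int)"
  interpret G: group ?G by (rule group_grading_group)
  have "?h \<in> hom integer_group ?G"
    by (auto simp: hom_def carrier_grading_group grading_group_def distrib_left restrict_def fun_eq_iff)
  then interpret h: group_hom integer_group ?G ?h by (intro group_hom.intro group_hom_axioms.intro group_integer_group G.group_axioms)
  have pow: "(d, \<lambda>j\<in>{1..r}. 0) [^]\<^bsub>?G\<^esub> t = ?h t" for t :: int
    using h.hom_int_pow[of 1 t] by simp
  have "(d, \<lambda>j\<in>{1..r}. 0) \<in> carrier ?G" by (auto simp: carrier_grading_group)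
  from G.generate_pow[OF this] show ?thesis unfolding pow by blast
qed

lemma Least_pos_multiple:
  fixes d :: nat
  assumes "0 < d"
  shows "(LEAST k. 0 < k \<and> d dvd k) = d"
  using assms by (intro Least_equality) (auto intro: dvd_imp_le)

section \<open>The smallest Cartier multiple of the anticanonical divisor\<close>

context graded_fan
begin

text \<open>All coefficients of the anticanonical divisor are 1, so its \<open>k\<close>-th multiple
  has degree and torsion equal to \<open>k\<close> times the sums of the weights and of the
  \<open>\<eta> i j\<close>. The order criterion shows that the Cartier multiples are those with
  \<open>k\<close> divisible by \<open>?d\<close>, and \<open>?d\<close> is positive, hence itself
  the least such \<open>k\<close>.\<close>

lemma gorenstein_index_eq:
  "gorenstein_index P = lcm (L * M div gcd (L * M) (\<Sum>i\<in>UNIV. w i))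
     (LCM j\<in>{1..r}. \<mu> j div gcd (\<mu> j) (\<Sum>i\<in>UNIV. \<eta> i j))" (is "_ = ?d")
proof -
  have anticanonical: "anticanonical_divisor $ i = (1 :: int)" for i :: 'm
    by (simp add: anticanonical_divisor_def prime_divisor_def axis_def)
  have "L \<noteq> 0" using w_pos unfolding L_def by (subst Lcm_0_iff) (auto simp: image_iff Suc_le_eq)
  moreover have "M \<noteq> 0" using mu_pos unfolding M_def
    by (subst Lcm_0_iff) (auto simp: image_iff Suc_le_eq less_not_refl2[OF div_gcd_pos])
  ultimately have LM: "0 < L * M" by simp
  have "cartier P (int k *s anticanonical_divisor) \<longleftrightarrow> ?d dvd k" for k
  proof -
    have degree: "degree (int k *s anticanonical_divisor) = int (k * (\<Sum>i\<in>UNIV. w i))"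
      by (simp add: degree_def anticanonical sum_distrib_left)
    have torsion: "torsion j (int k *s anticanonical_divisor) = int (k * (\<Sum>i\<in>UNIV. \<eta> i j))" for j
      by (simp add: torsion_def anticanonical sum_distrib_left)
    have "cartier P (int k *s anticanonical_divisor) \<longleftrightarrow>
        L * M dvd k * (\<Sum>i\<in>UNIV. w i) \<and> (\<forall>j\<in>{1..r}. \<mu> j dvd k * (\<Sum>i\<in>UNIV. \<eta> i j))"
      by (simp only: cartier_iff_dvd degree torsion int_dvd_int_iff)
    also have "\<dots> \<longleftrightarrow> L * M div gcd (L * M) (\<Sum>i\<in>UNIV. w i) dvd k \<and>
        (\<forall>j\<in>{1..r}. \<mu> j div gcd (\<mu> j) (\<Sum>i\<in>UNIV. \<eta> i j) dvd k)"
      using LM mu_pos by (simp add: dvd_mult_iff_div_gcd_dvd Suc_le_eq)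
    also have "\<dots> \<longleftrightarrow> ?d dvd k" by (simp add: Lcm_dvd_iff)
    finally show ?thesis .
  qed
  moreover have "0 < ?d"
  proof -
    have "0 < L * M div gcd (L * M) (\<Sum>i\<in>UNIV. w i)" by (intro div_gcd_pos LM)
    moreover have "0 < \<mu> j div gcd (\<mu> j) (\<Sum>i\<in>UNIV. \<eta> i j)" if "j \<in> {1..r}" for j
      using mu_pos[OF that] by (intro div_gcd_pos) simp
    then have "0 \<notin> (\<lambda>j. \<mu> j div gcd (\<mu> j) (\<Sum>i\<in>UNIV. \<eta> i j)) ` {1..r}" by force
    then have "(LCM j\<in>{1..r}. \<mu> j div gcd (\<mu> j) (\<Sum>i\<in>UNIV. \<eta> i j)) \<noteq> 0" by (subst Lcm_0_iff) auto
    ultimately show ?thesis by (metis lcm_pos_nat neq0_conv)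
  qed
  ultimately show ?thesis by (simp only: gorenstein_index_def Least_pos_multiple)
qed

end

theorem theorem3p3:
  fixes P :: "int ^ 'm ^ 'n"
    and r :: nat
    and \<mu> :: "nat \<Rightarrow> nat"
    and \<Phi> :: "(int ^ 'm) set \<Rightarrow> int \<times> (nat \<Rightarrow> int)"
    and w :: "'m \<Rightarrow> nat"
    and \<eta> :: "'m \<Rightarrow> nat \<Rightarrow> nat"
    and L M :: nat
    and Lij :: "'m \<Rightarrow> nat \<Rightarrow> nat"
    and Mj :: "nat \<Rightarrow> nat"
  assumes "fwps_matrix P"
    and "\<And>j. j \<in> {1..r} \<Longrightarrow> 1 \<le> \<mu> j"
    and "\<And>j. j \<in> {1..<r} \<Longrightarrow> \<mu> (j + 1) dvd \<mu> j"
    and "\<Phi> \<in> iso (class_group P) (grading_group r \<mu>)"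
    and "\<And>i. 1 \<le> w i"
    and "\<And>i j. j \<in> {1..r} \<Longrightarrow> \<eta> i j \<in> {0..\<mu> j - 1}"
    and "\<And>i. \<Phi> (divisor_class P (prime_divisor i)) =
               (int (w i), \<lambda>j\<in>{1..r}. int (\<eta> i j))"
    and "L = (LCM i\<in>UNIV. w i)"
    and "\<And>i j. Lij i j = L div w i * \<eta> i j"
    and "\<And>j. Mj j = \<mu> j div gcd (\<mu> j) (GCD i\<in>UNIV. Lij i j)"
    and "M = (LCM j\<in>{1..r}. Mj j)"
  shows "\<Phi> ` picard_group P =
           generate (grading_group r \<mu>) {(int (L * M), \<lambda>j\<in>{1..r}. 0)} \<and>
         gorenstein_index P =
           lcm (L * M div gcd (L * M) (\<Sum>i\<in>UNIV. w i))
               (LCM j\<in>{1..r}. \<mu> j div gcd (\<mu> j) (\<Sum>i\<in>UNIV. \<eta> i j))"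
proof -
  interpret fan: graded_fan P r \<mu> \<Phi> w \<eta>
    using assms(1,2,4,5,7) by unfold_locales
  have L: "L = fan.L" by (simp add: assms(8) fan.L_def)
  have M: "M = fan.M" by (simp add: assms(9-11) fan.M_def flip: L)
  show ?thesis
    unfolding L M fan.image_picard_group fan.gorenstein_index_eq generate_degree by simp
qed

end
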